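(* Let $A\in\mathbb{R}^{d\times d}$, let $B\in\mathbb{R}^{d\times d}$ be symmetric positive definite, and consider the one-sample zeroth-order method (Algorithm 1, described in the context). If $\dim(G_{\max})=d-1$, then the iterate $v^1$ generated by Algorithm 1 lies almost surely in $G_{\max}$. In other words, Algorithm 1 terminates almost surely after one step.
   Context: $\langle\cdot,\cdot\rangle$ and $\|\cdot\|$ are the Euclidean inner product and norm. Put $A^{\mathrm H}=\tfrac12(A+A^{\mathrm T})$, $\|v\|_B=\sqrt{\langle v,Bv\rangle}$, $\mathbb{S}_B^{d-1}=\{v\in\mathbb{R}^d:\|v\|_B=1\}$. For $v\in\mathbb{S}_B^{d-1}$ let $T_v=\{x\in\mathbb{R}^d:\langle x,Bv\rangle=0\}$ and let $P_v y=y-\frac{\langle y,Bv\rangle}{\|Bv\|^2}Bv$ be the Euclidean orthogonal projection onto $T_v$. The generalized Rayleigh quotient is $r(A,B,v)=\frac{\langle v,Av\rangle}{\langle v,Bv\rangle}$ for $v\ne0$, and $\mathcal{R}(A,B)=\max_{v\neq 0} r(A,B,v)$. A number $\lambda\in\mathbb{R}$ is a generalized eigenvalue of $(A^{\mathrm H},B)$ if $A^{\mathrm H}v=\lambda Bv$ for some $v\ne0$; $G_\lambda=\{v\in\mathbb{R}^d\setminus\{0\}:A^{\mathrm H}v=\lambda Bv\}$, and $\dim(G_\lambda)$ denotes the dimension of the linear subspace $G_\lambda\cup\{0\}$. $\mathcal{R}(A,B)$ is the largest generalized eigenvalue and $G_{\max}=G_{\mathcal{R}(A,B)}$. Algorithm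 1: Initialize $v^0=\tilde v/\|\tilde v\|_B$ with $\tilde v\sim\mathcal{N}(0,I_d)$. For $k=0,1,2,\dots$: sample $\tilde x\sim\mathcal{N}(0,I_d)$ independently of everything before and set $x^k=P_{v^k}\tilde x/\|P_{v^k}\tilde x\|$; if $\langle x^k,A^{\mathrm H}v^k\rangle=0$, stop; otherwise let $\tau_k=\operatorname{argmax}_{\tau\in\mathbb{R}} r(A,B,v^k+\tau x^k)$ (the maximizer exists and is unique in this case) and set $v^{k+1}=\frac{v^k+\tau_kx^k}{\|v^k+\tau_kx^k\|_B}$. "Terminates after one step" means that $v^1$ is computed and the stopping criterion is met in iteration $k=1$. *)

theory Defs
  imports "HOL-Probability.Probability"
begin

definition sym_pos_def :: "real^'n^'n \<Rightarrow> bool" where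
  "sym_pos_def B \<longleftrightarrow> transpose B = B \<and> (\<forall>v. v \<noteq> 0 \<longrightarrow> v \<bullet> (B *v v) > 0)"

definition sym_part :: "real^'n^'n \<Rightarrow> real^'n^'n" where
  "sym_part A = (1/2) *\<^sub>R (A + transpose A)"

definition norm_wrt :: "real^'n^'n \<Rightarrow> real^'n \<Rightarrow> real" where
  "norm_wrt B v = sqrt (v \<bullet> (B *v v))"

text \<open>Euclidean orthogonal projection of \<open>y\<close> onto \<open>T\<^sub>v = {x. x \<bullet> (B *v v) = 0}\<close>.\<close>

definition tangent_proj :: "real^'n^'n \<Rightarrow> real^'n \<Rightarrow> real^'n \<Rightarrow> real^'n" where
  "tangent_proj B v y = y - ((y \<bullet> (B *v v)) / (norm (B *v v))\<^sup>2) *\<^sub>R (B *v v)"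

definition rayleigh :: "real^'n^'n \<Rightarrow> real^'n^'n \<Rightarrow> real^'n \<Rightarrow> real" where
  "rayleigh A B v = (v \<bullet> (A *v v)) / (v \<bullet> (B *v v))"

definition rayleigh_max :: "real^'n^'n \<Rightarrow> real^'n^'n \<Rightarrow> real" where
  "rayleigh_max A B = (GREATEST s. \<exists>v. v \<noteq> 0 \<and> s = rayleigh A B v)"

definition gen_eigvecs :: "real^'n^'n \<Rightarrow> real^'n^'n \<Rightarrow> real \<Rightarrow> (real^'n) set" where
  "gen_eigvecs A B l = {v. v \<noteq> 0 \<and> sym_part A *v v = l *\<^sub>R (B *v v)}"

definition G_max :: "real^'n^'n \<Rightarrow> real^'n^'n \<Rightarrow> (real^'n) set" where
  "G_max A B = gen_eigvecs A B (rayleigh_max A B)"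

definition search_dir :: "real^'n^'n \<Rightarrow> real^'n \<Rightarrow> real^'n \<Rightarrow> real^'n" where
  "search_dir B v y = tangent_proj B v y /\<^sub>R norm (tangent_proj B v y)"

definition stops :: "real^'n^'n \<Rightarrow> real^'n \<Rightarrow> real^'n \<Rightarrow> bool" where
  "stops A v x \<longleftrightarrow> x \<bullet> (sym_part A *v v) = 0"

text \<open>
  \<open>arg_max\<close> is a choice operator; it is only used when \<open>\<not> stops A v x\<close>, in which case the maximizer
  over the line exists and is unique.
\<close>

definition step_size :: "real^'n^'n \<Rightarrow> real^'n^'n \<Rightarrow> real^'n \<Rightarrow> real^'n \<Rightarrow> real" where
  "step_size A B v x = arg_max (\<lambda>t. rayleigh A B (v + t *\<^sub>R x)) (\<lambda>t. True)"

definition update :: "real^'n^'n \<Rightarrow> real^'n^'n \<Rightarrow> real^'n \<Rightarrow> real^'n \<Rightarrow> real^'n" where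
  "update A B v x =
     (let w = v + step_size A B v x *\<^sub>R x in w /\<^sub>R norm_wrt B w)"

text \<open>
  The algorithm run on fixed samples: \<open>y\<close> is the initial sample and \<open>z k\<close> the sample drawn in
  iteration \<open>k\<close>. The value of \<open>iterate A B y z k\<close> is \<open>Some\<close> of the \<open>k\<close>-th iterate, or \<open>None\<close> if the
  algorithm has stopped in an iteration before \<open>k\<close>, so that this iterate is never computed.
\<close>

primrec iterate ::
  "real^'n^'n \<Rightarrow> real^'n^'n \<Rightarrow> real^'n \<Rightarrow> (nat \<Rightarrow> real^'n) \<Rightarrow> nat \<Rightarrow> (real^'n) option"
where
  "iterate A B y z 0 = Some (y /\<^sub>R norm_wrt B y)"
| "iterate A B y z (Suc k) =
     (case iterate A B y z k of
        None \<Rightarrow> None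
      | Some v \<Rightarrow>
          (let x = search_dir B v (z k) in
           if stops A v x then None else Some (update A B v x)))"

definition terminates_after ::
  "real^'n^'n \<Rightarrow> real^'n^'n \<Rightarrow> real^'n \<Rightarrow> (nat \<Rightarrow> real^'n) \<Rightarrow> nat \<Rightarrow> bool"
where
  "terminates_after A B y z k \<longleftrightarrow>
     (\<exists>v. iterate A B y z k = Some v \<and> stops A v (search_dir B v (z k)))"

definition std_gaussian :: "'w measure \<Rightarrow> ('w \<Rightarrow> real^'n) \<Rightarrow> bool" where
  "std_gaussian M X \<longleftrightarrow>
     distributed M lborel X (\<lambda>x. ennreal (\<Prod>i\<in>UNIV. std_normal_density (x $ i)))"

text \<open>
  The samples of the algorithm as random variables: \<open>Y\<close> is the initial sample and \<open>Z k\<close> the one of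
  iteration \<open>k\<close>. All of \<open>Y, Z 0, Z 1, \<dots>\<close> are jointly independent, which is the same as each \<open>Z k\<close>
  being independent of everything drawn before it. The sequence is infinite also when the
  algorithm stops; the later samples are then not used by \<open>iterate\<close>.
\<close>

definition gaussian_samples ::
  "'w measure \<Rightarrow> ('w \<Rightarrow> real^'n) \<Rightarrow> (nat \<Rightarrow> 'w \<Rightarrow> real^'n) \<Rightarrow> bool"
where
  "gaussian_samples M Y Z \<longleftrightarrow>
     std_gaussian M Y \<and> (\<forall>k. std_gaussian M (Z k)) \<and>
     prob_space.indep_vars M (\<lambda>_. borel) (case_nat Y Z) UNIV"

end

theory Submission
  imports Defs
begin

text \<open>
  Write \<open>R\<close> for the maximal Rayleigh quotient. The matrix \<open>R B - A\<^sup>H\<close> is positive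
  semidefinite and its kernel is a hyperplane \<open>a\<^sup>\<bottom>\<close>, so \<open>(R B - A\<^sup>H) x = c (a \<bullet> x) a\<close> with
  \<open>c > 0\<close>. As soon as \<open>a\<close> is orthogonal neither to the initial iterate nor to the search direction,
  the first iteration does not stop and the search line meets \<open>a\<^sup>\<bottom>\<close>, which is where the Rayleigh
  quotient on the line is maximal; hence \<open>v\<^sup>1\<close> is a maximal eigenvector. The two exceptional
  events have probability zero because hyperplanes are Lebesgue null sets.
\<close>

section \<open>Rayleigh quotients and positive semidefinite matrices\<close>

lemma inner_symmetric_matrix:
  fixes S :: "real^'n^'n"
  assumes "transpose S = S"
  shows "x \<bullet> (S *v y) = (S *v x) \<bullet> y"
  by (metis assms dot_lmul_matrix transpose_matrix_vector)

lemma transpose_sym_part: "transpose (sym_part A) = sym_part A"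
  by (simp add: sym_part_def transpose_def vec_eq_iff)

lemma inner_sym_part: "v \<bullet> (sym_part A *v v) = v \<bullet> (A *v v)"
proof -
  have "v \<bullet> (transpose A *v v) = v \<bullet> (A *v v)"
    by (metis dot_lmul_matrix inner_commute transpose_matrix_vector)
  then show ?thesis
    by (simp add: sym_part_def scaleR_matrix_vector_assoc[symmetric]
        matrix_vector_mult_add_rdistrib inner_add_right)
qed

lemma inner_sym_pos_def_eq_0_iff:
  assumes "sym_pos_def B"
  shows "v \<bullet> (B *v v) = 0 \<longleftrightarrow> v = 0"
  using assms by (force simp: sym_pos_def_def)

lemma rayleigh_scaleR:
  assumes "k \<noteq> 0"
  shows "rayleigh A B (k *\<^sub>R v) = rayleigh A B v"
  using assms by (simp add: rayleigh_def matrix_vector_mult_scaleR)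

text \<open>Scale invariance reduces the maximization to the compact unit sphere, where continuity
  yields a maximizer. This gives \<open>GREATEST\<close> in \<open>rayleigh_max\<close> its intended
  meaning.\<close>

lemma rayleigh_max_greatest:
  fixes A B :: "real^'n^'n"
  assumes B: "sym_pos_def B"
  shows "\<exists>v. v \<noteq> 0 \<and> rayleigh A B v = rayleigh_max A B"
    and "v \<noteq> 0 \<Longrightarrow> rayleigh A B v \<le> rayleigh_max A B"
proof -
  have "continuous_on (sphere 0 1) (rayleigh A B)"
    unfolding rayleigh_def
    by (intro continuous_intros matrix_vector_mult_linear_continuous_on)
      (auto simp: inner_sym_pos_def_eq_0_iff[OF B])
  moreover have "(sphere 0 1 :: (real^'n) set) \<noteq> {}"
    by simp
  ultimately obtain u where u: "u \<in> sphere 0 1"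
    "\<And>w. w \<in> sphere 0 1 \<Longrightarrow> rayleigh A B w \<le> rayleigh A B u"
    using continuous_attains_sup[OF compact_sphere] by metis
  have le: "rayleigh A B w \<le> rayleigh A B u" if "w \<noteq> 0" for w
    using u(2)[of "inverse (norm w) *\<^sub>R w"] that by (simp add: rayleigh_scaleR)
  have "u \<noteq> 0"
    using u(1) by auto
  then have "rayleigh_max A B = rayleigh A B u"
    unfolding rayleigh_max_def by (intro Greatest_equality) (use le in auto)
  then show "\<exists>v. v \<noteq> 0 \<and> rayleigh A B v = rayleigh_max A B"
    and "v \<noteq> 0 \<Longrightarrow> rayleigh A B v \<le> rayleigh_max A B"
    using le \<open>u \<noteq> 0\<close> by auto
qed

text \<open>A symmetric map preserves the orthogonal complement of its kernel, so \<open>a\<close>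
  is an eigenvector. Its eigenvalue is nonnegative by semidefiniteness and nonzero because
  \<open>a\<close> is not in the kernel.\<close>

lemma psd_hyperplane_kernel_rank_one:
  fixes S :: "real^'n^'n"
  assumes sym: "transpose S = S"
    and psd: "\<And>x. 0 \<le> x \<bullet> (S *v x)"
    and "a \<noteq> 0"
    and ker: "\<And>x. S *v x = 0 \<longleftrightarrow> a \<bullet> x = 0"
  obtains c where "c > 0" "\<And>x. S *v x = (c * (a \<bullet> x)) *\<^sub>R a"
proof -
  \<comment> \<open>With this Rayleigh quotient \<open>m\<close>, the vector \<open>p\<close> is the
    component of \<open>S *v a\<close> orthogonal to \<open>a\<close>; it lies in the kernel, which
    forces it to vanish.\<close>
  define m where "m = (a \<bullet> (S *v a)) / (a \<bullet> a)"
  define p where "p = S *v a - m *\<^sub>R a"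
  have aa: "a \<bullet> a > 0"
    using \<open>a \<noteq> 0\<close> by simp
  have ap: "a \<bullet> p = 0"
    using aa by (simp add: p_def m_def inner_diff_right)
  have "p \<bullet> (S *v a) = 0"
    using ker[of p] ap by (simp add: inner_symmetric_matrix[OF sym])
  then have "p \<bullet> p = 0"
    using ap by (simp add: p_def inner_diff_right inner_commute)
  then have Sa: "S *v a = m *\<^sub>R a"
    by (simp add: p_def)
  have "S *v a \<noteq> 0"
    using ker[of a] aa by simp
  moreover have "m \<ge> 0"
    using psd[of a] aa by (simp add: m_def)
  ultimately have "m > 0"
    using Sa by (cases "m = 0") auto
  have "S *v x = (m / (a \<bullet> a) * (a \<bullet> x)) *\<^sub>R a" for x
  proof -
    have "S *v (x - ((a \<bullet> x) / (a \<bullet> a)) *\<^sub>R a) = 0"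
      unfolding ker using aa by (simp add: inner_diff_right)
    then show ?thesis
      by (simp add: matrix_vector_mult_diff_distrib matrix_vector_mult_scaleR Sa mult.commute)
  qed
  with \<open>m > 0\<close> aa show ?thesis
    by (intro that[of "m / (a \<bullet> a)"]) auto
qed

text \<open>If \<open>S *v u\<close> were nonzero, a small step from \<open>u\<close> against it
  would make the quadratic form negative: the first-order decrease dominates the second-order
  term.\<close>

lemma psd_inner_eq_0_imp_kernel:
  fixes S :: "real^'n^'n"
  assumes sym: "transpose S = S"
    and psd: "\<And>x. 0 \<le> x \<bullet> (S *v x)"
    and u: "u \<bullet> (S *v u) = 0"
  shows "S *v u = 0"
proof (rule ccontr)
  assume "S *v u \<noteq> 0"
  define w where "w = S *v u"
  define q where "q = w \<bullet> (S *v w)"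
  \<comment> \<open>The step must satisfy \<open>s * q < 2 * (w \<bullet> w)\<close>; the
    \<open>+ 1\<close> keeps the denominator positive when \<open>q = 0\<close>.\<close>
  define s where "s = (w \<bullet> w) / (q + 1)"
  have ww: "w \<bullet> w > 0" and "q \<ge> 0"
    using \<open>S *v u \<noteq> 0\<close> psd by (auto simp: w_def q_def)
  have "(u - s *\<^sub>R w) \<bullet> (S *v (u - s *\<^sub>R w)) = s\<^sup>2 * q - 2 * s * (w \<bullet> w)"
    using u inner_symmetric_matrix[OF sym, of u w]
    by (simp add: matrix_vector_mult_diff_distrib matrix_vector_mult_scaleR inner_diff_left
        inner_diff_right q_def w_def[symmetric] power2_eq_square right_diff_distrib)
  also have "\<dots> = s * (s * q - 2 * (w \<bullet> w))"
    by (simp add: power2_eq_square algebra_simps)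
  also have "\<dots> < 0"
  proof (intro mult_pos_neg)
    show "s > 0"
      using ww \<open>q \<ge> 0\<close> by (simp add: s_def)
    moreover have "s * (q + 1) = w \<bullet> w"
      using \<open>q \<ge> 0\<close> by (simp add: s_def)
    ultimately show "s * q - 2 * (w \<bullet> w) < 0"
      using ww unfolding distrib_left by linarith
  qed
  finally show False
    using psd[of "u - s *\<^sub>R w"] by simp
qed

section \<open>The gap matrix and its kernel\<close>

definition eig_gap :: "real^'n^'n \<Rightarrow> real^'n^'n \<Rightarrow> real^'n^'n" where
  "eig_gap A B = rayleigh_max A B *\<^sub>R B - sym_part A"

lemma eig_gap_mult:
  "eig_gap A B *v x = rayleigh_max A B *\<^sub>R (B *v x) - sym_part A *v x"
  by (simp add: eig_gap_def matrix_vector_mult_diff_rdistrib scaleR_matrix_vector_assoc)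

lemma G_max_iff: "v \<in> G_max A B \<longleftrightarrow> v \<noteq> 0 \<and> eig_gap A B *v v = 0"
  by (auto simp: G_max_def gen_eigvecs_def eig_gap_mult)

lemma transpose_eig_gap:
  assumes "sym_pos_def B"
  shows "transpose (eig_gap A B) = eig_gap A B"
proof -
  have "transpose B = B"
    using assms by (simp add: sym_pos_def_def)
  with transpose_sym_part[of A] show ?thesis
    by (simp add: eig_gap_def transpose_def vec_eq_iff)
qed

text \<open>Translates between Rayleigh quotients and the quadratic form of \<open>eig_gap\<close>.
  At \<open>v = 0\<close> both sides vanish whatever value the quotient has there.\<close>

lemma inner_eig_gap:
  assumes B: "sym_pos_def B"
  shows "v \<bullet> (eig_gap A B *v v) = (rayleigh_max A B - rayleigh A B v) * (v \<bullet> (B *v v))"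
proof (cases "v = 0")
  case False
  then have "v \<bullet> (B *v v) \<noteq> 0"
    by (simp add: inner_sym_pos_def_eq_0_iff[OF B])
  then show ?thesis
    by (simp add: eig_gap_mult inner_diff_right inner_sym_part rayleigh_def algebra_simps)
qed simp

lemma eig_gap_psd:
  assumes B: "sym_pos_def B"
  shows "0 \<le> v \<bullet> (eig_gap A B *v v)"
proof (cases "v = 0")
  case False
  then have "0 < v \<bullet> (B *v v)"
    using B by (simp add: sym_pos_def_def)
  with rayleigh_max_greatest(2)[OF B False, of A] show ?thesis
    by (simp add: inner_eig_gap[OF B])
qed simp

text \<open>Attaining the maximum makes the semidefinite quadratic form of \<open>eig_gap\<close>
  vanish, which puts the vector in the kernel.\<close>

lemma G_max_eq_rayleigh_max:
  assumes B: "sym_pos_def B"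
  shows "v \<in> G_max A B \<longleftrightarrow> v \<noteq> 0 \<and> rayleigh A B v = rayleigh_max A B"
proof (cases "v = 0")
  case False
  then have "v \<bullet> (B *v v) \<noteq> 0"
    by (simp add: inner_sym_pos_def_eq_0_iff[OF B])
  with False show ?thesis
    using inner_eig_gap[OF B, of v A]
      psd_inner_eq_0_imp_kernel[OF transpose_eig_gap[OF B] eig_gap_psd[OF B], of v A]
    by (auto simp: G_max_iff)
qed (simp add: G_max_iff)

lemma G_max_hyperplane:
  fixes A B :: "real^'n^'n"
  assumes B: "sym_pos_def B" and dim: "dim (G_max A B \<union> {0}) = CARD('n) - 1"
  obtains a c where "a \<noteq> 0" "c > 0" "\<And>x. eig_gap A B *v x = (c * (a \<bullet> x)) *\<^sub>R a"
    "CARD('n) \<ge> 2"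
proof -
  have eq: "G_max A B \<union> {0} = {x. eig_gap A B *v x = 0}"
    by (auto simp: G_max_iff)
  have sub: "subspace {x. eig_gap A B *v x = 0}"
    by (simp add: subspace_def matrix_vector_right_distrib matrix_vector_mult_scaleR)
  obtain a where a: "a \<noteq> 0" "span (G_max A B \<union> {0}) = {x. a \<bullet> x = 0}"
    using lowdim_eq_hyperplane[of "G_max A B \<union> {0}"] dim by auto
  then have "\<And>x. eig_gap A B *v x = 0 \<longleftrightarrow> a \<bullet> x = 0"
    using eq sub by (metis (mono_tags, lifting) mem_Collect_eq span_eq_iff)
  then obtain c where c: "c > 0" "\<And>x. eig_gap A B *v x = (c * (a \<bullet> x)) *\<^sub>R a"
    using psd_hyperplane_kernel_rank_one[OF transpose_eig_gap[OF B] eig_gap_psd[OF B] a(1)] by metis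
  \<comment> \<open>The maximum is attained, so the eigenspace is nontrivial and its dimension
    \<open>CARD('n) - 1\<close> is at least one.\<close>
  obtain u where "u \<in> G_max A B"
    using rayleigh_max_greatest(1)[OF B, of A] G_max_eq_rayleigh_max[OF B, of _ A] by auto
  then have "u \<noteq> 0" "u \<in> G_max A B \<union> {0}"
    by (auto simp: G_max_iff)
  then have "dim (G_max A B \<union> {0}) \<noteq> 0"
    by (metis dim_eq_0 singletonD subsetD)
  with dim have "CARD('n) \<ge> 2"
    by linarith
  with a(1) c show ?thesis
    by (rule that)
qed

section \<open>Tangent projection and the first iteration\<close>

lemma tangent_proj_orthogonal: "tangent_proj B v y \<bullet> (B *v v) = 0"
  by (cases "B *v v = 0") (simp_all add: tangent_proj_def inner_diff_left power2_norm_eq_inner)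

lemma search_dir_orthogonal: "search_dir B v y \<bullet> (B *v v) = 0"
  by (simp add: search_dir_def tangent_proj_orthogonal)

text \<open>Only the line spanned by \<open>B *v v\<close> matters, so the projection at the
  normalized initial iterate can be computed from the raw sample.\<close>

lemma tangent_proj_scaleR:
  assumes "k \<noteq> 0"
  shows "tangent_proj B (k *\<^sub>R v) y = tangent_proj B v y"
  using assms
  by (simp add: tangent_proj_def matrix_vector_mult_scaleR power_mult_distrib power2_eq_square[of k])

lemma inner_tangent_proj_commute:
  "a \<bullet> tangent_proj B y z = tangent_proj B y a \<bullet> z"
  by (simp add: tangent_proj_def inner_diff_left inner_diff_right inner_commute)

text \<open>At such an eigenvector \<open>sym_part A *v v\<close> is a multiple of
  \<open>B *v v\<close>, to which every search direction is orthogonal.\<close>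

lemma stops_at_G_max:
  assumes "v \<in> G_max A B"
  shows "stops A v (search_dir B v y)"
  using assms search_dir_orthogonal[of B v y]
  by (simp add: stops_def G_max_def gen_eigvecs_def)

text \<open>The search line crosses the hyperplane orthogonal to \<open>a\<close>, where the
  quotient reaches its global maximum. Whichever maximizer \<open>arg_max\<close> selects therefore
  attains that value too.\<close>

lemma update_in_G_max:
  fixes A B :: "real^'n^'n"
  assumes B: "sym_pos_def B"
    and S: "\<And>x. eig_gap A B *v x = (c * (a \<bullet> x)) *\<^sub>R a"
    and "v \<noteq> 0" and vx: "x \<bullet> (B *v v) = 0" and ax: "a \<bullet> x \<noteq> 0"
  shows "update A B v x \<in> G_max A B"
proof -
  \<comment> \<open>Since \<open>v\<close> and \<open>x\<close> are orthogonal with respect to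
    \<open>B\<close>, the line avoids the origin.\<close>
  have nz: "v + t *\<^sub>R x \<noteq> 0" for t
  proof
    assume "v + t *\<^sub>R x = 0"
    then have "(v + t *\<^sub>R x) \<bullet> (B *v v) = 0"
      by simp
    then have "v \<bullet> (B *v v) = 0"
      using vx by (simp add: inner_add_left)
    then show False
      using \<open>v \<noteq> 0\<close> by (simp add: inner_sym_pos_def_eq_0_iff[OF B])
  qed
  define f where "f t = rayleigh A B (v + t *\<^sub>R x)" for t
  \<comment> \<open>This is the solution of
    \<open>a \<bullet> (v + t *\<^sub>R x) = 0\<close>.\<close>
  define t0 where "t0 = - (a \<bullet> v) / (a \<bullet> x)"
  have "eig_gap A B *v (v + t0 *\<^sub>R x) = 0"
    using ax by (simp add: S inner_add_right inner_diff_right t0_def)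
  then have f0: "f t0 = rayleigh_max A B"
    using nz[of t0] G_max_eq_rayleigh_max[OF B, of "v + t0 *\<^sub>R x" A] by (simp add: G_max_iff f_def)
  have fle: "f t \<le> rayleigh_max A B" for t
    using rayleigh_max_greatest(2)[OF B nz] by (simp add: f_def)
  define t where "t = step_size A B v x"
  have "is_arg_max f (\<lambda>_. True) (arg_max f (\<lambda>_. True))"
    unfolding arg_max_def by (rule someI[of _ t0]) (simp add: is_arg_max_linorder f0 fle)
  then have "f t0 \<le> f t"
    by (simp add: is_arg_max_linorder t_def step_size_def f_def[abs_def])
  then have "f t = rayleigh_max A B"
    using f0 fle[of t] by simp
  then have w: "rayleigh A B (v + t *\<^sub>R x) = rayleigh_max A B"
    by (simp add: f_def)
  have "norm_wrt B (v + t *\<^sub>R x) \<noteq> 0"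
    using nz[of t] by (simp add: norm_wrt_def inner_sym_pos_def_eq_0_iff[OF B])
  with w nz[of t] show ?thesis
    by (simp add: G_max_eq_rayleigh_max[OF B] update_def Let_def t_def[symmetric] rayleigh_scaleR)
qed

lemma first_step_in_G_max:
  fixes A B :: "real^'n^'n"
  assumes B: "sym_pos_def B"
    and S: "\<And>x. eig_gap A B *v x = (c * (a \<bullet> x)) *\<^sub>R a" and "c > 0"
    and y: "a \<bullet> y \<noteq> 0" and p: "a \<bullet> tangent_proj B y (z 0) \<noteq> 0"
  shows "\<exists>v\<in>G_max A B. iterate A B y z 1 = Some v"
proof -
  define v where "v = y /\<^sub>R norm_wrt B y"
  define x where "x = search_dir B v (z 0)"
  have "y \<noteq> 0"
    using y by auto
  then have k: "inverse (norm_wrt B y) \<noteq> 0"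
    by (simp add: norm_wrt_def inner_sym_pos_def_eq_0_iff[OF B])
  have "v \<noteq> 0" and av: "a \<bullet> v \<noteq> 0"
    using k y \<open>y \<noteq> 0\<close> by (auto simp: v_def)
  have "tangent_proj B v (z 0) = tangent_proj B y (z 0)"
    unfolding v_def by (rule tangent_proj_scaleR[OF k])
  then have ax: "a \<bullet> x \<noteq> 0"
    using p by (auto simp: x_def search_dir_def)
  have vx: "x \<bullet> (B *v v) = 0"
    by (simp add: x_def search_dir_orthogonal)
  \<comment> \<open>On tangent directions the stopping quantity is, up to sign, the gap form, which
    equals \<open>c * (a \<bullet> v) * (a \<bullet> x)\<close>.\<close>
  have "x \<bullet> (sym_part A *v v) = - (x \<bullet> (eig_gap A B *v v))"
    using vx by (simp add: eig_gap_mult inner_diff_right)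
  also have "\<dots> \<noteq> 0"
    using ax av \<open>c > 0\<close> by (simp add: S inner_commute)
  finally have "\<not> stops A v x"
    by (simp add: stops_def)
  then have "iterate A B y z 1 = Some (update A B v x)"
    by (simp add: v_def[symmetric] x_def[symmetric])
  with update_in_G_max[OF B S \<open>v \<noteq> 0\<close> vx ax] show ?thesis
    by auto
qed

section \<open>Null events for Gaussian samples\<close>

lemma std_gaussian_measurable:
  "std_gaussian M X \<Longrightarrow> X \<in> borel_measurable M"
  by (simp add: std_gaussian_def distributed_def)

text \<open>The Gaussian law has a density with respect to \<open>lborel\<close>, hence is
  absolutely continuous.\<close>

lemma std_gaussian_AE_distr:
  fixes X :: "'w \<Rightarrow> real^'n"
  assumes "std_gaussian M X" and "AE x in lborel. P x"
  shows "AE x in distr M borel X. P x"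
proof -
  have "distr M borel X = distr M lborel X"
    by (rule distr_cong) simp_all
  then show ?thesis
    using assms unfolding std_gaussian_def distributed_def by (simp only: AE_density) auto
qed

lemma std_gaussian_AE_not_orthogonal:
  fixes X :: "'w \<Rightarrow> real^'n"
  assumes X: "std_gaussian M X" and "b \<noteq> 0"
  shows "AE x in distr M borel X. b \<bullet> x \<noteq> 0"
proof (rule std_gaussian_AE_distr[OF X])
  have "{x. b \<bullet> x = 0} \<in> null_sets lebesgue"
    using negligible_hyperplane[of b 0] \<open>b \<noteq> 0\<close> by (simp add: negligible_iff_null_sets)
  then have "AE x in completion lborel. b \<bullet> x \<noteq> 0"
    by (rule AE_I') auto
  then show "AE x in lborel. b \<bullet> x \<noteq> 0"
    by (simp add: AE_completion_iff)
qed

text \<open>Independence of the disjoint blocks \<open>{i}\<close> and \<open>{j}\<close>, followed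
  by projection to the single coordinate of each.\<close>

lemma indep_vars_imp_indep_var:
  assumes "prob_space M" and "prob_space.indep_vars M (\<lambda>_. N) X I"
    and "i \<in> I" "j \<in> I" "i \<noteq> j"
  shows "prob_space.indep_var M N (X i) N (X j)"
proof -
  interpret prob_space M by fact
  have "indep_var (PiM {i} (\<lambda>_. N)) (\<lambda>\<omega>. restrict (\<lambda>k. X k \<omega>) {i})
    (PiM {j} (\<lambda>_. N)) (\<lambda>\<omega>. restrict (\<lambda>k. X k \<omega>) {j})"
    using assms by (intro indep_var_restrict) auto
  then have "indep_var N ((\<lambda>g. g i) \<circ> (\<lambda>\<omega>. restrict (\<lambda>k. X k \<omega>) {i}))
    N ((\<lambda>g. g j) \<circ> (\<lambda>\<omega>. restrict (\<lambda>k. X k \<omega>) {j}))"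
    by (rule indep_var_compose) auto
  then show ?thesis
    by (simp add: comp_def)
qed

text \<open>
  The scalar \<open>a \<bullet> tangent_proj B y z\<close> is the inner product of \<open>z\<close> with the projection of \<open>a\<close>
  (the projection is self-adjoint), and that projection vanishes only if \<open>a\<close> is parallel to
  \<open>B y\<close>. Any nonzero \<open>b\<close> orthogonal to \<open>a\<close>, which exists in dimension at least two, rules
  this out for almost every \<open>y\<close>.
\<close>

lemma AE_tangent_proj_not_orthogonal:
  fixes B :: "real^'n^'n"
  assumes "prob_space M"
    and Y: "std_gaussian M Y" and Z: "std_gaussian M Z"
    and indep: "prob_space.indep_var M borel Y borel Z"
    and B: "sym_pos_def B" and "a \<noteq> 0" and card: "CARD('n) \<ge> 2"
  shows "AE \<omega> in M. a \<bullet> tangent_proj B (Y \<omega>) (Z \<omega>) \<noteq> 0"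
proof -
  interpret prob_space M by fact
  have mY: "Y \<in> borel_measurable M" and mZ: "Z \<in> borel_measurable M"
    using Y Z by (simp_all add: std_gaussian_measurable)
  let ?D = "distr M borel Y" and ?E = "distr M borel Z"
  interpret D: prob_space ?D by (rule prob_space_distr[OF mY])
  interpret E: prob_space ?E by (rule prob_space_distr[OF mZ])
  interpret DE: pair_prob_space ?D ?E ..
  have symB: "transpose B = B"
    using B by (simp add: sym_pos_def_def)
  obtain b where b: "b \<noteq> 0" "a \<bullet> b = 0"
    using orthogonal_to_vector_exists[of a] card by (auto simp: orthogonal_def)
  have Bb: "B *v b \<noteq> 0"
    using B b(1) by (force simp: sym_pos_def_def)
  have proj: "tangent_proj B y a \<noteq> 0" if "(B *v b) \<bullet> y \<noteq> 0" for y
  proof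
    define k where "k = (a \<bullet> (B *v y)) / (norm (B *v y))\<^sup>2"
    assume "tangent_proj B y a = 0"
    then have "a = k *\<^sub>R (B *v y)"
      by (simp add: tangent_proj_def k_def)
    then have "k * (b \<bullet> (B *v y)) = 0" "k \<noteq> 0"
      using b(2) \<open>a \<noteq> 0\<close> by (auto simp: inner_commute)
    then show False
      using that by (simp add: inner_symmetric_matrix[OF symB])
  qed
  \<comment> \<open>For fixed \<open>y\<close> off the hyperplane orthogonal to
    \<open>B *v b\<close>, the bad \<open>z\<close> form the hyperplane orthogonal to the nonzero
    projection of \<open>a\<close>.\<close>
  have "AE y in ?D. AE z in ?E. a \<bullet> tangent_proj B (fst (y, z)) (snd (y, z)) \<noteq> 0"
    using std_gaussian_AE_not_orthogonal[OF Y Bb]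
  proof eventually_elim
    case (elim y)
    show ?case
      using std_gaussian_AE_not_orthogonal[OF Z proj[OF elim]]
      by (simp add: inner_tangent_proj_commute)
  qed
  moreover have "{q \<in> space (?D \<Otimes>\<^sub>M ?E). a \<bullet> tangent_proj B (fst q) (snd q) \<noteq> 0}
      \<in> sets (?D \<Otimes>\<^sub>M ?E)"
  proof -
    have [measurable]: "(\<lambda>x. B *v x) \<in> borel_measurable borel"
      by (intro borel_measurable_continuous_onI matrix_vector_mult_linear_continuous_on)
    show ?thesis
      unfolding tangent_proj_def by measurable
  qed
  ultimately have "AE q in ?D \<Otimes>\<^sub>M ?E. a \<bullet> tangent_proj B (fst q) (snd q) \<noteq> 0"
    by (intro DE.AE_pair_measure)
  \<comment> \<open>By independence, the joint law of the two samples is the product of their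
    laws.\<close>
  then have "AE q in distr M (borel \<Otimes>\<^sub>M borel) (\<lambda>\<omega>. (Y \<omega>, Z \<omega>)).
      a \<bullet> tangent_proj B (fst q) (snd q) \<noteq> 0"
    using indep by (simp only: indep_var_distribution_eq)
  then show ?thesis
    using mY mZ by (auto dest!: AE_distrD[rotated])
qed

theorem theorem4p5:
  fixes A B :: "real^'n^'n"
    and M :: "'w measure"
    and Y :: "'w \<Rightarrow> real^'n"
    and Z :: "nat \<Rightarrow> 'w \<Rightarrow> real^'n"
  assumes "sym_pos_def B"
    and "prob_space M"
    and "gaussian_samples M Y Z"
    and "dim (G_max A B \<union> {0}) = CARD('n) - 1"
  shows "(AE \<omega> in M. \<exists>v\<in>G_max A B. iterate A B (Y \<omega>) (\<lambda>k. Z k \<omega>) 1 = Some v) \<and>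
         (AE \<omega> in M. terminates_after A B (Y \<omega>) (\<lambda>k. Z k \<omega>) 1)"
proof -
  obtain a c where "a \<noteq> 0" "c > 0" and S: "\<And>x. eig_gap A B *v x = (c * (a \<bullet> x)) *\<^sub>R a"
    and card: "CARD('n) \<ge> 2"
    using G_max_hyperplane[OF assms(1,4)] by metis
  have Y: "std_gaussian M Y" and Z: "std_gaussian M (Z 0)"
    and indep: "prob_space.indep_vars M (\<lambda>_. borel) (case_nat Y Z) UNIV"
    using assms(3) by (auto simp: gaussian_samples_def)
  have "prob_space.indep_var M borel Y borel (Z 0)"
    \<comment> \<open>In \<open>case_nat Y Z\<close>, index 0 is \<open>Y\<close> and index 1 is
      \<open>Z 0\<close>.\<close>
    using indep_vars_imp_indep_var[OF assms(2) indep, of 0 1] by simp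
  then have "AE \<omega> in M. a \<bullet> tangent_proj B (Y \<omega>) (Z 0 \<omega>) \<noteq> 0"
    using AE_tangent_proj_not_orthogonal[OF assms(2) Y Z _ assms(1) \<open>a \<noteq> 0\<close> card] by simp
  moreover have "AE \<omega> in M. a \<bullet> Y \<omega> \<noteq> 0"
    using AE_distrD[OF std_gaussian_measurable[OF Y] std_gaussian_AE_not_orthogonal[OF Y \<open>a \<noteq> 0\<close>]] .
  ultimately have *: "AE \<omega> in M. \<exists>v\<in>G_max A B. iterate A B (Y \<omega>) (\<lambda>k. Z k \<omega>) 1 = Some v"
    by eventually_elim (rule first_step_in_G_max[OF assms(1) S \<open>c > 0\<close>])
  moreover have "AE \<omega> in M. terminates_after A B (Y \<omega>) (\<lambda>k. Z k \<omega>) 1"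
    \<comment> \<open>Once the first iterate is in \<open>G_max A B\<close>, the stopping test
      succeeds for every value of the next sample.\<close>
    using * by eventually_elim (auto simp: terminates_after_def simp del: iterate.simps intro: stops_at_G_max)
  ultimately show ?thesis ..
qed

end
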